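(* Let $d\ge 3$ be an integer all of whose nontrivial divisors (positive divisors other than $1$ and $d$) are prime. Let $\mathcal{H}$ be a complex Hilbert space of dimension $d$ with orthonormal bases $\mathcal{A}=\{|a_i\rangle\}_{i=0}^{d-1}$ and $\mathcal{B}=\{|b_j\rangle\}_{j=0}^{d-1}$ whose transition matrix is the discrete Fourier transform matrix, i.e. $\langle a_i|b_j\rangle=\frac{1}{\sqrt d}\,\omega_d^{ij}$ for all $i,j\in\{0,\dots,d-1\}$, where $\omega_d=e^{2\pi\sqrt{-1}/d}$. Let $n$ be an integer with $0\le n\le d$. Then the point $(d-n,3)$ belongs to $\mathrm{UNCD}(\mathcal{A},\mathcal{B})$ if and only if either $n=0$, or there exists a positive divisor $m$ of $d$ such that $3m\le d$ and ($n=m$ or $n=2m$).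
   Context: A state is a unit vector $|\psi\rangle\in\mathcal{H}$. Its support sizes are $n_{\mathcal{A}}(\psi)=|\{i:\langle a_i|\psi\rangle\neq 0\}|$ and $n_{\mathcal{B}}(\psi)=|\{j:\langle b_j|\psi\rangle\neq 0\}|$. The uncertainty diagram $\mathrm{UNCD}(\mathcal{A},\mathcal{B})$ is the set of pairs $(n_{\mathcal{A}},n_{\mathcal{B}})\in\{1,\dots,d\}\times\{1,\dots,d\}$ for which there exists a state $|\psi\rangle$ with $n_{\mathcal{A}}(\psi)=n_{\mathcal{A}}$ and $n_{\mathcal{B}}(\psi)=n_{\mathcal{B}}$. The divisor $m=1$ is allowed. *)

theory Defs
  imports Complex_Main "HOL-Computational_Algebra.Primes"
begin

(* The inner product is linear in its second argument, as in the bra-ket notation <x|y>.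
   Completeness is not part of the locale: it is only used for finite-dimensional spaces,
   where it holds automatically. *)
locale complex_inner_product_space = vector_space scale
  for scale :: "complex \<Rightarrow> 'a::ab_group_add \<Rightarrow> 'a" +
  fixes ip :: "'a \<Rightarrow> 'a \<Rightarrow> complex"
  assumes ip_add_right: "ip x (y + z) = ip x y + ip x z"
    and ip_scale_right: "ip x (scale c y) = c * ip x y"
    and ip_cnj: "ip y x = cnj (ip x y)"
    and ip_nonneg: "0 \<le> Re (ip x x)"
    and ip_definite: "ip x x = 0 \<Longrightarrow> x = 0"

definition orthonormal_basis ::
    "(complex \<Rightarrow> 'a::ab_group_add \<Rightarrow> 'a) \<Rightarrow> ('a \<Rightarrow> 'a \<Rightarrow> complex) \<Rightarrow> nat \<Rightarrow> (nat \<Rightarrow> 'a) \<Rightarrow> bool" where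
  "orthonormal_basis scale ip d e \<longleftrightarrow>
     (\<forall>i<d. \<forall>j<d. ip (e i) (e j) = (if i = j then 1 else 0)) \<and>
     module.span scale (e ` {..<d}) = UNIV"

definition is_state :: "('a \<Rightarrow> 'a \<Rightarrow> complex) \<Rightarrow> 'a \<Rightarrow> bool" where
  "is_state ip \<psi> \<longleftrightarrow> sqrt (Re (ip \<psi> \<psi>)) = 1"

definition support_size ::
    "('a \<Rightarrow> 'a \<Rightarrow> complex) \<Rightarrow> nat \<Rightarrow> (nat \<Rightarrow> 'a) \<Rightarrow> 'a \<Rightarrow> nat" where
  "support_size ip d e \<psi> = card {i. i < d \<and> ip (e i) \<psi> \<noteq> 0}"

definition UNCD ::
    "('a \<Rightarrow> 'a \<Rightarrow> complex) \<Rightarrow> nat \<Rightarrow> (nat \<Rightarrow> 'a) \<Rightarrow> (nat \<Rightarrow> 'a) \<Rightarrow> (nat \<times> nat) set" where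
  "UNCD ip d a b =
     {(k, l). k \<in> {1..d} \<and> l \<in> {1..d} \<and>
        (\<exists>\<psi>. is_state ip \<psi> \<and> support_size ip d a \<psi> = k \<and> support_size ip d b \<psi> = l)}"

definition root_unity :: "nat \<Rightarrow> complex" where
  "root_unity d = exp (2 * of_real pi * \<i> / of_nat d)"

end

theory Submission
  imports Defs "HOL-Computational_Algebra.Polynomial"
begin

text \<open>
  Expanding a state in the basis \<open>b\<close>, the number \<open>n\<close> is the number of zeros \<open>i < d\<close> of
  a trinomial \<open>c\<^sub>0 + c\<^sub>1 \<omega>\<^bsup>iu\<^esup> + c\<^sub>2 \<omega>\<^bsup>iv\<^esup>\<close> with \<open>0 < u < v < d\<close>. With \<open>g = gcd(u, v, d)\<close> the pair
  \<open>(\<omega>\<^bsup>iu\<^esup>, \<omega>\<^bsup>iv\<^esup>)\<close> determines \<open>i\<close> exactly modulo \<open>d/g\<close>. A triangle with given side lengths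
  is unique up to reflection, so at most two such pairs are zeros and \<open>n\<close> is \<open>0\<close>, \<open>g\<close> or \<open>2g\<close>; moreover
  \<open>d/g > v/g > u/g > 0\<close> gives \<open>3g \<le> d\<close>. Conversely, for \<open>d = mk\<close> the trinomial
  \<open>(y - r)(y - s)\<close> in \<open>y = \<omega>\<^bsup>mi\<^esup>\<close> has \<open>0\<close>, \<open>m\<close> or \<open>2m\<close> zeros, depending on how many of \<open>r\<close>, \<open>s\<close>
  are \<open>k\<close>-th roots of unity.
\<close>

section \<open>Powers of the root of unity and periodic counting\<close>

lemma root_unity_power_eq_iff:
  assumes "d > 0"
  shows "root_unity d ^ k = root_unity d ^ l \<longleftrightarrow> k mod d = l mod d"
proof -
  have cis: "root_unity d ^ j = cis (2 * pi * real j / real d)" for j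
  proof -
    have "root_unity d = cis (2 * pi / real d)"
      by (simp add: root_unity_def cis_conv_exp field_simps)
    then show ?thesis
      by (simp add: DeMoivre field_simps)
  qed
  have "root_unity d ^ d = 1"
    using assms by (simp add: cis)
  then have "root_unity d ^ j = root_unity d ^ (j mod d)" for j
    by (metis mult_div_mod_eq power_add power_mult power_one mult_1)
  moreover have "inj_on (\<lambda>j. root_unity d ^ j) {..<d}"
    using bij_betw_roots_unity[OF assms] by (simp add: bij_betw_def cis)
  ultimately show ?thesis
    using assms by (metis inj_on_eq_iff lessThan_iff mod_less_divisor)
qed

lemma norm_root_unity_power [simp]: "norm (root_unity d ^ k) = 1"
proof -
  have "root_unity d = cis (2 * pi / real d)"
    by (simp add: root_unity_def cis_conv_exp field_simps)
  then show ?thesis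
    by (simp add: norm_power)
qed

lemma root_unity_nonzero [simp]: "root_unity d \<noteq> 0"
  by (simp add: root_unity_def)

text \<open>Division by \<open>k\<close> turns \<open>i\<close> into a pair of block and residue.
  This serves to count the zeros of a function of period \<open>k\<close> over \<open>g\<close> full
  periods.\<close>

lemma card_less_mod:
  assumes "k > 0"
  shows "card {i. i < g * k \<and> P (i mod k)} = g * card {r. r < k \<and> P r}"
proof -
  have "bij_betw (\<lambda>(q, r). q * k + r) ({..<g} \<times> {r. r < k \<and> P r}) {i. i < g * k \<and> P (i mod k)}"
  proof (rule bij_betw_byWitness[where f' = "\<lambda>i. (i div k, i mod k)"])
    show "(\<lambda>(q, r). q * k + r) ` ({..<g} \<times> {r. r < k \<and> P r}) \<subseteq> {i. i < g * k \<and> P (i mod k)}"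
    proof clarsimp
      fix q r assume "q < g" "r < k"
      then have "q * k + r < Suc q * k" by simp
      also have "\<dots> \<le> g * k" using \<open>q < g\<close> by (intro mult_right_mono) auto
      finally show "q * k + r < g * k" .
    qed
  qed (use assms in \<open>auto simp: less_mult_imp_div_less\<close>)
  then have "card ({..<g} \<times> {r. r < k \<and> P r}) = card {i. i < g * k \<and> P (i mod k)}"
    by (rule bij_betw_same_card)
  then show ?thesis
    by (simp add: card_cartesian_product)
qed

section \<open>Zeros of trinomials on the unit circle\<close>

text \<open>The triangle argument in algebraic form: \<open>x\<close> is a root of a nonzero
  quadratic, and it determines \<open>y\<close> because \<open>c2 \<noteq> 0\<close>.\<close>

lemma unit_trinomial_solutions:
  fixes c0 c1 c2 :: complex
  assumes "c0 \<noteq> 0" "c1 \<noteq> 0" "c2 \<noteq> 0"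
  defines "Z \<equiv> {(x, y). norm x = 1 \<and> norm y = 1 \<and> c0 + c1 * x + c2 * y = 0}"
  shows "finite Z" and "card Z \<le> 2"
proof -
  \<comment> \<open>These are the coefficients of
    \<open>(c0 + c1 * x) * (cnj c0 * x + cnj c1) - c2 * cnj c2 * x\<close>. The middle one may
    vanish, the outer two cannot.\<close>
  define p where "p = [:c0 * cnj c1, c0 * cnj c0 + c1 * cnj c1 - c2 * cnj c2, cnj c0 * c1:]"
  have p: "p \<noteq> 0" "degree p \<le> 2"
    using assms by (auto simp: p_def)
  \<comment> \<open>Conjugation on the unit circle is inversion, so \<open>\<bar>c0 + c1 * x\<bar> = \<bar>c2\<bar>\<close> is quadratic in \<open>x\<close>.\<close>
  have root: "poly p x = 0" if "(x, y) \<in> Z" for x y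
  proof -
    have xy: "x * cnj x = 1" "y * cnj y = 1" and eq: "c0 + c1 * x = - (c2 * y)"
      using that by (auto simp: Z_def complex_norm_square[symmetric] eq_neg_iff_add_eq_0)
    have "(c0 + c1 * x) * cnj (c0 + c1 * x) = c2 * cnj c2"
      unfolding eq using xy by (simp add: algebra_simps)
    then have "(c0 + c1 * x) * (cnj c0 + cnj c1 * cnj x) * x = c2 * cnj c2 * x"
      by simp
    moreover have "(c0 + c1 * x) * (cnj c0 + cnj c1 * cnj x) * x
        = (c0 + c1 * x) * (cnj c0 * x + cnj c1 * (x * cnj x))"
      by (simp add: algebra_simps)
    ultimately have "(c0 + c1 * x) * (cnj c0 * x + cnj c1) = c2 * cnj c2 * x"
      using xy by simp
    then show ?thesis
      by (simp add: p_def algebra_simps)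
  qed
  have inj: "inj_on fst Z"
  proof (rule inj_onI)
    fix z w assume "z \<in> Z" "w \<in> Z" "fst z = fst w"
    then have "c0 + c1 * fst w + c2 * snd z = 0" "c0 + c1 * fst w + c2 * snd w = 0"
      by (auto simp: Z_def)
    then have "c2 * snd z = c2 * snd w"
      by (metis add_left_cancel)
    then show "z = w"
      using \<open>c2 \<noteq> 0\<close> \<open>fst z = fst w\<close> by (simp add: prod_eq_iff)
  qed
  have img: "fst ` Z \<subseteq> {x. poly p x = 0}"
    using root by auto
  have fin: "finite {x. poly p x = 0}"
    using p poly_roots_finite by blast
  show "finite Z"
    using inj img fin finite_imageD finite_subset by blast
  have "card Z \<le> card {x. poly p x = 0}"
    using card_mono[OF fin img] card_image[OF inj] by simp
  also have "\<dots> \<le> 2"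
    using card_poly_roots_bound[OF p(1)] p(2) by linarith
  finally show "card Z \<le> 2" .
qed

text \<open>The zeros fill whole residue classes modulo \<open>d div g\<close>, each with
  \<open>g\<close> members below \<open>d\<close>, and distinct classes give distinct solutions on
  the unit circle.\<close>

lemma card_zeros_trinomial:
  fixes c0 c1 c2 :: complex
  assumes "0 < u" "u < v" "v < d" and c: "c0 \<noteq> 0" "c1 \<noteq> 0" "c2 \<noteq> 0"
  defines "w \<equiv> root_unity d"
  obtains g where "g > 0" "g dvd d" "3 * g \<le> d"
    "card {i. i < d \<and> c0 + c1 * w ^ (i * u) + c2 * w ^ (i * v) = 0} \<in> {0, g, 2 * g}"
proof -
  define g where "g = gcd (gcd u v) d"
  have "d > 0" and g: "g > 0" "g dvd u" "g dvd v" "g dvd d"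
    using assms by (auto simp: g_def intro: dvd_trans)
  obtain u' v' k where uvk: "u = u' * g" "v = v' * g" "d = g * k"
    using g by (metis dvd_def mult.commute)
  \<comment> \<open>The chain \<open>0 < u' < v' < k\<close> forces \<open>k \<ge> 3\<close>, which
    is the source of \<open>3 * g \<le> d\<close>.\<close>
  have "u' > 0" "u' < v'" "v' < k"
    using assms g uvk by (auto simp: mult.commute)
  then have "k > 0" "3 * g \<le> d"
    using uvk by auto
  \<comment> \<open>Differences are taken in the integers, where they do not truncate.\<close>
  have mod_eq: "x mod l = y mod l \<longleftrightarrow> int l dvd int x - int y" for x y l
    by (metis mod_eq_dvd_iff of_nat_eq_iff of_nat_mod)
  have eq_iff: "w ^ (i * u) = w ^ (j * u) \<and> w ^ (i * v) = w ^ (j * v) \<longleftrightarrow> i mod k = j mod k" for i j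
  proof -
    have *: "w ^ (i * s) = w ^ (j * s) \<longleftrightarrow> int d dvd (int i - int j) * int s" for s
      unfolding w_def root_unity_power_eq_iff[OF \<open>d > 0\<close>] mod_eq
      by (simp add: left_diff_distrib)
    have gi: "int g = gcd (gcd (int u) (int v)) (int d)"
      by (simp add: g_def)
    \<comment> \<open>A common factor leaves an integer gcd only as its absolute value, so the sign
      is discarded first; divisibility does not notice.\<close>
    have abs: "int d dvd (int i - int j) * int s \<longleftrightarrow> int d dvd \<bar>int i - int j\<bar> * int s" for s
      by (metis abs_mult abs_of_nat dvd_abs_iff)
    have "int d dvd (int i - int j) * int u \<and> int d dvd (int i - int j) * int v
        \<longleftrightarrow> int d dvd (int i - int j) * int g" (is "?l \<longleftrightarrow> ?r")
    proof
      assume ?l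
      \<comment> \<open>The third argument comes for free, since \<open>d\<close> divides every
        multiple of itself.\<close>
      then have "int d dvd gcd (gcd (\<bar>int i - int j\<bar> * int u) (\<bar>int i - int j\<bar> * int v)) (\<bar>int i - int j\<bar> * int d)"
        by (simp add: abs)
      also have "\<dots> = \<bar>int i - int j\<bar> * int g"
        by (simp only: gi gcd_mult_distrib_int[symmetric] abs_idempotent)
      finally show ?r
        by (simp add: abs)
    next
      assume ?r
      then show ?l
        using g by (meson dvd_trans int_dvd_int_iff mult_dvd_mono dvd_refl)
    qed
    also have "\<dots> \<longleftrightarrow> int k dvd int i - int j"
      using g by (simp add: uvk mult.commute)
    also have "\<dots> \<longleftrightarrow> i mod k = j mod k"
      by (simp add: mod_eq)
    finally show ?thesis
      by (simp add: *)
  qed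
  let ?P = "\<lambda>i. c0 + c1 * w ^ (i * u) + c2 * w ^ (i * v) = 0"
  have "?P (i mod k) \<longleftrightarrow> ?P i" for i
    using eq_iff[of "i mod k" i] by simp
  then have card: "card {i. i < d \<and> ?P i} = g * card {r. r < k \<and> ?P r}"
    using card_less_mod[OF \<open>k > 0\<close>, of g ?P] uvk(3) by simp
  have "card {r. r < k \<and> ?P r} \<le> card {(x, y). norm x = 1 \<and> norm y = 1 \<and> c0 + c1 * x + c2 * y = 0}"
  proof (rule card_inj_on_le[where f = "\<lambda>r. (w ^ (r * u), w ^ (r * v))"])
    show "inj_on (\<lambda>r. (w ^ (r * u), w ^ (r * v))) {r. r < k \<and> ?P r}"
    proof (rule inj_onI)
      fix x y assume "x \<in> {r. r < k \<and> ?P r}" "y \<in> {r. r < k \<and> ?P r}"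
        "(w ^ (x * u), w ^ (x * v)) = (w ^ (y * u), w ^ (y * v))"
      then show "x = y"
        using eq_iff[of x y] by simp
    qed
  qed (use unit_trinomial_solutions(1)[OF c] in \<open>auto simp: w_def\<close>)
  also have "\<dots> \<le> 2"
    by (rule unit_trinomial_solutions(2)[OF c])
  finally have le: "card {r. r < k \<and> ?P r} \<le> 2" .
  have "g * t \<in> {0, g, 2 * g}" if "t \<le> 2" for t
    using that by (auto simp: le_Suc_eq numeral_2_eq_2)
  from this[OF le] show ?thesis
    unfolding card[symmetric] by (rule that[OF g(1) g(4) \<open>3 * g \<le> d\<close>])
qed

section \<open>Fourier sums with three nonzero coefficients\<close>

text \<open>The increasing order makes the differences from \<open>j0\<close> admissible as
  trinomial exponents. Leaving \<open>h\<close> arbitrary lets one choice of indices serve every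
  frequency \<open>i\<close>.\<close>

lemma sum_support_card3:
  fixes f :: "nat \<Rightarrow> 'b::comm_semiring_0"
  assumes "card {j. j < d \<and> f j \<noteq> 0} = 3"
  obtains j0 j1 j2 where "j0 < j1" "j1 < j2" "j2 < d" "f j0 \<noteq> 0" "f j1 \<noteq> 0" "f j2 \<noteq> 0"
    "\<And>h. (\<Sum>j<d. f j * h j) = f j0 * h j0 + f j1 * h j1 + f j2 * h j2"
proof -
  let ?S = "{j. j < d \<and> f j \<noteq> 0}"
  define xs where "xs = sorted_list_of_set ?S"
  have "sorted_wrt (<) xs" "set xs = ?S" "length xs = 3"
    using assms by (simp_all add: xs_def)
  then obtain j0 j1 j2 where j: "j0 < j1" "j1 < j2" and S: "?S = {j0, j1, j2}"
    by (auto simp: numeral_3_eq_3 length_Suc_conv)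
  have "(\<Sum>j<d. f j * h j) = f j0 * h j0 + f j1 * h j1 + f j2 * h j2" for h
  proof -
    have "(\<Sum>j<d. f j * h j) = (\<Sum>j\<in>?S. f j * h j)"
      by (rule sum.mono_neutral_right) auto
    also have "\<dots> = f j0 * h j0 + f j1 * h j1 + f j2 * h j2"
      unfolding S using j by (simp add: add.assoc)
    finally show ?thesis .
  qed
  moreover have "j0 \<in> ?S" "j1 \<in> ?S" "j2 \<in> ?S"
    unfolding S by auto
  ultimately show ?thesis
    using that j by blast
qed

text \<open>Factoring out the power that belongs to the least index, which never vanishes, leaves a
  trinomial with a constant term.\<close>

lemma card_zeros_fourier_support3:
  fixes f :: "nat \<Rightarrow> complex"
  assumes "card {j. j < d \<and> f j \<noteq> 0} = 3"
  obtains g where "g > 0" "g dvd d" "3 * g \<le> d"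
    "card {i. i < d \<and> (\<Sum>j<d. f j * root_unity d ^ (i * j)) = 0} \<in> {0, g, 2 * g}"
proof -
  let ?w = "root_unity d"
  obtain j0 j1 j2 where j: "j0 < j1" "j1 < j2" "j2 < d" "f j0 \<noteq> 0" "f j1 \<noteq> 0" "f j2 \<noteq> 0"
    and sum: "\<And>h. (\<Sum>j<d. f j * h j) = f j0 * h j0 + f j1 * h j1 + f j2 * h j2"
    by (rule sum_support_card3[OF assms]) (rule that)
  have zero_iff: "(\<Sum>j<d. f j * ?w ^ (i * j)) = 0 \<longleftrightarrow>
      f j0 + f j1 * ?w ^ (i * (j1 - j0)) + f j2 * ?w ^ (i * (j2 - j0)) = 0" for i
  proof -
    have shift: "?w ^ (i * j) = ?w ^ (i * j0) * ?w ^ (i * (j - j0))" if "j0 \<le> j" for j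
      using that by (metis distrib_left le_add_diff_inverse power_add)
    have "(\<Sum>j<d. f j * ?w ^ (i * j)) =
        ?w ^ (i * j0) * (f j0 + f j1 * ?w ^ (i * (j1 - j0)) + f j2 * ?w ^ (i * (j2 - j0)))"
      using shift[of j1] shift[of j2] j unfolding sum by (simp add: distrib_left mult.left_commute)
    then show ?thesis
      by simp
  qed
  have "0 < j1 - j0" "j1 - j0 < j2 - j0" "j2 - j0 < d"
    using j by auto
  then show ?thesis
    by (rule card_zeros_trinomial[OF _ _ _ j(4-6)]) (rule that[unfolded zero_iff])
qed

text \<open>The coefficients are those of \<open>(y - r) * (y - s)\<close> with
  \<open>y = w ^ (i * m)\<close>, placed at 0, \<open>m\<close> and \<open>2 * m\<close>. The
  conditions on \<open>r\<close> and \<open>s\<close> keep all three nonzero,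
  \<open>k \<ge> 3\<close> keeps the indices below \<open>d\<close>, and \<open>y\<close> has period
  \<open>k\<close> in \<open>i\<close>.\<close>

lemma exists_fourier_support3:
  fixes r s :: complex
  assumes "m > 0" "k \<ge> 3" "d = m * k" and rs: "r \<noteq> 0" "s \<noteq> 0" "r + s \<noteq> 0"
  defines "w \<equiv> root_unity d"
  obtains f :: "nat \<Rightarrow> complex" where "card {j. j < d \<and> f j \<noteq> 0} = 3"
    "card {i. i < d \<and> (\<Sum>j<d. f j * w ^ (i * j)) = 0} =
      m * card {t. t < k \<and> (w ^ (t * m) = r \<or> w ^ (t * m) = s)}"
proof -
  define f where "f j = (if j = 0 then r * s else if j = m then - (r + s) else if j = 2 * m then 1 else 0)" for j
  have "3 * m \<le> d" "k > 0" "d > 0"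
    using assms by auto
  then have S: "{j. j < d \<and> f j \<noteq> 0} = {0, m, 2 * m}"
    using rs \<open>m > 0\<close> by (auto simp: f_def add_eq_0_iff2)
  have "(\<Sum>j<d. f j * w ^ (i * j)) = (w ^ (i * m) - r) * (w ^ (i * m) - s)" for i
  proof -
    have "(\<Sum>j<d. f j * w ^ (i * j)) = (\<Sum>j\<in>{0, m, 2 * m}. f j * w ^ (i * j))"
      unfolding S[symmetric] by (rule sum.mono_neutral_right) auto
    also have "\<dots> = r * s - (r + s) * w ^ (i * m) + w ^ (i * m * 2)"
      using \<open>m > 0\<close> by (simp add: f_def algebra_simps)
    also have "\<dots> = (w ^ (i * m) - r) * (w ^ (i * m) - s)"
      by (simp add: power_mult power2_eq_square algebra_simps)
    finally show ?thesis .
  qed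
  moreover have "w ^ (i mod k * m) = w ^ (i * m)" for i
    unfolding w_def root_unity_power_eq_iff[OF \<open>d > 0\<close>]
    by (simp add: assms(3) mult.commute[of m k] flip: mult_mod_left)
  ultimately have "card {i. i < d \<and> (\<Sum>j<d. f j * w ^ (i * j)) = 0} =
      m * card {t. t < k \<and> (w ^ (t * m) = r \<or> w ^ (t * m) = s)}"
    using card_less_mod[OF \<open>k > 0\<close>, of m "\<lambda>t. w ^ (t * m) = r \<or> w ^ (t * m) = s"]
    by (simp add: assms(3))
  moreover have "card {j. j < d \<and> f j \<noteq> 0} = 3"
    using \<open>m > 0\<close> by (simp add: S)
  ultimately show ?thesis
    using that by blast
qed

section \<open>Translation of states into Fourier sums\<close>

context complex_inner_product_space
begin

lemma ip_zero_right [simp]: "ip x 0 = 0"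
  using ip_scale_right[of x 0 0] by simp

lemma ip_sum_right: "ip x (\<Sum>j\<in>A. f j) = (\<Sum>j\<in>A. ip x (f j))"
  by (induction A rule: infinite_finite_induct) (simp_all add: ip_add_right)

text \<open>Both sides are linear in \<open>x\<close> and agree on the basis vectors, which span the
  space.\<close>

lemma orthonormal_basis_expansion:
  assumes "orthonormal_basis scale ip d e"
  shows "x = (\<Sum>j<d. scale (ip (e j) x) (e j))"
proof -
  have on: "ip (e i) (e j) = (if i = j then 1 else 0)" if "i < d" "j < d" for i j
    using assms that by (auto simp: orthonormal_basis_def)
  have "x \<in> span (e ` {..<d})"
    using assms by (simp add: orthonormal_basis_def)
  then show ?thesis
  proof (induction rule: span_induct_alt)
    case base
    then show ?case by simp
  next
    case (step c x y)
    then obtain i where i: "i < d" "x = e i" by auto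
    have "(\<Sum>j<d. scale (ip (e j) (e i)) (e j)) = (\<Sum>j<d. if j = i then e i else 0)"
      using i by (intro sum.cong) (auto simp: on)
    also have "\<dots> = e i"
      using i by simp
    finally have "scale c x = (\<Sum>j<d. scale (c * ip (e j) x) (e j))"
      using i by (simp flip: scale_scale scale_sum_right)
    then have "scale c x + y = (\<Sum>j<d. scale (c * ip (e j) x) (e j)) + (\<Sum>j<d. scale (ip (e j) y) (e j))"
      using step(2) by simp
    moreover have "(\<Sum>j<d. scale (ip (e j) (scale c x + y)) (e j)) =
        (\<Sum>j<d. scale (c * ip (e j) x) (e j)) + (\<Sum>j<d. scale (ip (e j) y) (e j))"
      by (simp add: ip_add_right ip_scale_right scale_left_distrib sum.distrib)
    ultimately show ?case
      by (rule trans[OF _ sym])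
  qed
qed

lemma exists_state_proportional:
  assumes "x \<noteq> 0"
  obtains c where "c \<noteq> 0" "is_state ip (scale c x)"
proof -
  \<comment> \<open>Since \<open>ip x x\<close> is real, definiteness excludes a vanishing real
    part.\<close>
  have "Im (ip x x) = 0"
    using ip_cnj[of x x] by (metis cnj.sel(2) neg_equal_zero)
  then have pos: "Re (ip x x) > 0"
    using ip_nonneg[of x] ip_definite[of x] assms by (metis complex_eq_iff order_le_less zero_complex.sel)
  define c where "c = complex_of_real (1 / sqrt (Re (ip x x)))"
  have "ip (scale c x) (scale c x) = c * cnj c * ip x x"
    by (metis complex_cnj_mult ip_cnj ip_scale_right mult.assoc)
  then have "Re (ip (scale c x) (scale c x)) = 1"
    using pos by (simp add: c_def flip: of_real_mult)
  then have "is_state ip (scale c x)"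
    by (simp add: is_state_def)
  moreover have "c \<noteq> 0"
    using pos by (simp add: c_def)
  ultimately show ?thesis
    using that by blast
qed

text \<open>Take \<open>f\<close> to be the coordinates in \<open>b\<close>. Those in
  \<open>a\<close> are then its Fourier sums up to the factor \<open>1 / sqrt d\<close>, and
  normalising a vector changes neither support.\<close>

lemma UNCD_fourier_iff:
  assumes a: "orthonormal_basis scale ip d a" and b: "orthonormal_basis scale ip d b"
    and ab: "\<And>i j. i < d \<Longrightarrow> j < d \<Longrightarrow>
      ip (a i) (b j) = 1 / complex_of_real (sqrt (real d)) * root_unity d ^ (i * j)"
    and "n < d" "l > 0"
  shows "(d - n, l) \<in> UNCD ip d a b \<longleftrightarrow>
    (\<exists>f. card {j. j < d \<and> f j \<noteq> 0} = l \<and>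
         card {i. i < d \<and> (\<Sum>j<d. f j * root_unity d ^ (i * j)) = 0} = n)"
proof -
  let ?w = "root_unity d"
  have supp: "support_size ip d a x = d - card {i. i < d \<and> (\<Sum>j<d. ip (b j) x * ?w ^ (i * j)) = 0}" for x
  proof -
    have "ip (a i) x = 1 / complex_of_real (sqrt (real d)) * (\<Sum>j<d. ip (b j) x * ?w ^ (i * j))"
      if "i < d" for i
    proof -
      have "ip (a i) x = (\<Sum>j<d. ip (b j) x * ip (a i) (b j))"
        by (subst orthonormal_basis_expansion[OF b, of x]) (simp add: ip_sum_right ip_scale_right)
      then show ?thesis
        using that by (simp add: ab sum_divide_distrib)
    qed
    then have "{i. i < d \<and> ip (a i) x \<noteq> 0} = {..<d} - {i. i < d \<and> (\<Sum>j<d. ip (b j) x * ?w ^ (i * j)) = 0}"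
      by auto
    then show ?thesis
      by (simp add: support_size_def card_Diff_subset subset_eq)
  qed
  have zeros_le: "card {i. i < d \<and> P i} \<le> d" for P
    using card_mono[of "{..<d}" "{i. i < d \<and> P i}"] by auto
  show ?thesis
  proof
    assume "(d - n, l) \<in> UNCD ip d a b"
    then obtain x where "support_size ip d a x = d - n" "support_size ip d b x = l"
      by (auto simp: UNCD_def)
    \<comment> \<open>The zero count and \<open>n\<close> are both at most \<open>d\<close>, so the
      truncated subtraction from \<open>d\<close> can be cancelled.\<close>
    then show "\<exists>f. card {j. j < d \<and> f j \<noteq> 0} = l \<and>
        card {i. i < d \<and> (\<Sum>j<d. f j * ?w ^ (i * j)) = 0} = n"
      using \<open>n < d\<close> zeros_le unfolding supp
      by (intro exI[of _ "\<lambda>j. ip (b j) x"]) (auto simp: support_size_def intro: diff_diff_eq2)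
  next
    assume "\<exists>f. card {j. j < d \<and> f j \<noteq> 0} = l \<and>
        card {i. i < d \<and> (\<Sum>j<d. f j * ?w ^ (i * j)) = 0} = n"
    then obtain f where f: "card {j. j < d \<and> f j \<noteq> 0} = l"
        "card {i. i < d \<and> (\<Sum>j<d. f j * ?w ^ (i * j)) = 0} = n"
      by blast
    define x where "x = (\<Sum>j<d. scale (f j) (b j))"
    have ip_x: "ip (b i) x = f i" if "i < d" for i
    proof -
      have "ip (b i) x = (\<Sum>j<d. if j = i then f j else 0)"
        unfolding x_def ip_sum_right using b that
        by (intro sum.cong) (auto simp: ip_scale_right orthonormal_basis_def)
      then show ?thesis
        using that by simp
    qed
    have "{j. j < d \<and> f j \<noteq> 0} \<noteq> {}"
      using f(1) \<open>l > 0\<close> by (metis card.empty less_irrefl)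
    then obtain j where "j < d" "f j \<noteq> 0"
      by blast
    then have "x \<noteq> 0"
      using ip_x by force
    then obtain c where c: "c \<noteq> 0" "is_state ip (scale c x)"
      by (rule exists_state_proportional)
    have "(\<Sum>j<d. ip (b j) (scale c x) * ?w ^ (i * j)) = c * (\<Sum>j<d. f j * ?w ^ (i * j))" for i
      by (simp add: ip_scale_right ip_x sum_distrib_left mult.assoc)
    then have "support_size ip d a (scale c x) = d - n"
      unfolding supp using c f by simp
    moreover have "support_size ip d b (scale c x) = card {j. j < d \<and> f j \<noteq> 0}"
      unfolding support_size_def using c
      by (intro arg_cong[where f = card]) (auto simp: ip_scale_right ip_x)
    moreover have "l \<le> d"
      using zeros_le[of "\<lambda>j. f j \<noteq> 0"] f(1) by simp
    ultimately show "(d - n, l) \<in> UNCD ip d a b"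
      using c f \<open>n < d\<close> \<open>l > 0\<close> by (auto simp: UNCD_def)
  qed
qed

end

section \<open>The equivalence for support size 3\<close>

theorem theorem3:
  fixes scale :: "complex \<Rightarrow> 'a::ab_group_add \<Rightarrow> 'a"
    and ip :: "'a \<Rightarrow> 'a \<Rightarrow> complex"
    and a b :: "nat \<Rightarrow> 'a"
    and d n :: nat
  assumes "d \<ge> 3"
    and "\<And>m. m dvd d \<Longrightarrow> m \<noteq> 1 \<Longrightarrow> m \<noteq> d \<Longrightarrow> prime m"
    and "complex_inner_product_space scale ip"
    and "vector_space.dim scale (UNIV :: 'a set) = d"
    and "orthonormal_basis scale ip d a"
    and "orthonormal_basis scale ip d b"
    and "\<And>i j. i < d \<Longrightarrow> j < d \<Longrightarrow>
           ip (a i) (b j) = 1 / complex_of_real (sqrt (real d)) * root_unity d ^ (i * j)"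
    and "n \<le> d"
  shows "(d - n, 3) \<in> UNCD ip d a b \<longleftrightarrow>
           n = 0 \<or> (\<exists>m. m > 0 \<and> m dvd d \<and> 3 * m \<le> d \<and> (n = m \<or> n = 2 * m))"
proof -
  have iff: "(d - n, 3) \<in> UNCD ip d a b \<longleftrightarrow>
      (\<exists>f. card {j. j < d \<and> f j \<noteq> 0} = 3 \<and>
           card {i. i < d \<and> (\<Sum>j<d. f j * root_unity d ^ (i * j)) = 0} = n)" if "n < d"
    using that by (intro complex_inner_product_space.UNCD_fourier_iff[OF assms(3,5,6)] assms) auto
  show ?thesis
  proof
    assume *: "(d - n, 3) \<in> UNCD ip d a b"
    \<comment> \<open>Points of the diagram have first coordinate at least 1. In the converse
      direction \<open>n \<le> 2 * m < 3 * m \<le> d\<close> gives the same bound.\<close>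
    then have "n < d"
      using assms(8) by (auto simp: UNCD_def)
    obtain f where f: "card {j. j < d \<and> f j \<noteq> 0} = 3"
      and n: "card {i. i < d \<and> (\<Sum>j<d. f j * root_unity d ^ (i * j)) = 0} = n"
      using * unfolding iff[OF \<open>n < d\<close>] by blast
    from f show "n = 0 \<or> (\<exists>m. m > 0 \<and> m dvd d \<and> 3 * m \<le> d \<and> (n = m \<or> n = 2 * m))"
      by (rule card_zeros_fourier_support3) (unfold n, blast)
  next
    assume *: "n = 0 \<or> (\<exists>m. m > 0 \<and> m dvd d \<and> 3 * m \<le> d \<and> (n = m \<or> n = 2 * m))"
    then have "n < d"
      using assms(1) by auto
    let ?w = "root_unity d"
    \<comment> \<open>For \<open>t < k\<close> the values \<open>?w ^ (t * m)\<close> run through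
      the \<open>k\<close>-th roots of unity, so \<open>r\<close> and \<open>s\<close> are chosen to
      hit as many of them as \<open>n\<close> requires.\<close>
    have "\<exists>m k r s. m > 0 \<and> k \<ge> 3 \<and> d = m * k \<and> r \<noteq> 0 \<and> s \<noteq> 0 \<and> r + s \<noteq> 0 \<and>
        n = m * card {t. t < k \<and> (?w ^ (t * m) = r \<or> ?w ^ (t * m) = s)}"
    proof (cases "n = 0")
      case True
      \<comment> \<open>No zeros: 2 and 3 both lie off the unit circle.\<close>
      have "{t. t < d \<and> (?w ^ (t * 1) = 2 \<or> ?w ^ (t * 1) = 3)} = {}"
        using norm_root_unity_power[of d] by (auto dest: arg_cong[where f = norm])
      then show ?thesis
        using assms(1) True
        by (intro exI[of _ 1] exI[of _ d] exI[of _ 2] exI[of _ 3]) simp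
    next
      case False
      then obtain m k where m: "m > 0" "3 * m \<le> d" "n = m \<or> n = 2 * m" and d: "d = m * k"
        using * by (auto simp: dvd_def)
      then have "k \<ge> 3" "d > 0"
        by auto
      have inj: "?w ^ (t * m) = ?w ^ (t' * m) \<longleftrightarrow> t = t'" if "t < k" "t' < k" for t t'
        unfolding root_unity_power_eq_iff[OF \<open>d > 0\<close>] using that m d by (simp add: mult.commute)
      then have eq1: "?w ^ (t * m) = 1 \<longleftrightarrow> t = 0" if "t < k" for t
        using inj[of t 0] that by simp
      from m(3) show ?thesis
      proof
        assume "n = m"
        \<comment> \<open>One zero per period: \<open>r = 1\<close> is a root of unity,
          \<open>s = 2\<close> is off the circle.\<close>
        have "?w ^ (t * m) \<noteq> 2" for t
          using norm_root_unity_power[of d "t * m"] by (auto dest: arg_cong[where f = norm])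
        then have "{t. t < k \<and> (?w ^ (t * m) = 1 \<or> ?w ^ (t * m) = 2)} = {0}"
          using eq1 \<open>k \<ge> 3\<close> by auto
        then show ?thesis
          using m(1) \<open>k \<ge> 3\<close> d \<open>n = m\<close>
          by (intro exI[of _ m] exI[of _ k] exI[of _ 1] exI[of _ 2]) simp
      next
        assume "n = 2 * m"
        \<comment> \<open>Two zeros per period: 1 and the primitive \<open>k\<close>-th root
          \<open>?w ^ m\<close>, attained at \<open>t = 0\<close> and \<open>t = 1\<close>.\<close>
        have "{t. t < k \<and> (?w ^ (t * m) = 1 \<or> ?w ^ (t * m) = ?w ^ m)} = {0, 1}"
          using eq1 inj[of _ 1] \<open>k \<ge> 3\<close> by auto
        \<comment> \<open>Otherwise \<open>?w ^ m\<close> would have order 2, but its order is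
          \<open>k \<ge> 3\<close>.\<close>
        moreover have "1 + ?w ^ m \<noteq> 0"
        proof
          assume "1 + ?w ^ m = 0"
          then have "?w ^ m = -1"
            by (simp add: add_eq_0_iff)
          then have "?w ^ (2 * m) = 1"
            by (simp add: power_mult power_even_eq mult.commute[of 2])
          then show False
            using eq1[of 2] \<open>k \<ge> 3\<close> by simp
        qed
        ultimately show ?thesis
          using m(1) \<open>k \<ge> 3\<close> d \<open>n = 2 * m\<close>
          by (intro exI[of _ m] exI[of _ k] exI[of _ 1] exI[of _ "?w ^ m"]) simp
      qed
    qed
    then obtain m k r s where mk: "m > 0" "k \<ge> 3" "d = m * k" "r \<noteq> 0" "s \<noteq> 0" "r + s \<noteq> 0"
      and n: "n = m * card {t. t < k \<and> (?w ^ (t * m) = r \<or> ?w ^ (t * m) = s)}"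
      by blast
    obtain f where "card {j. j < d \<and> f j \<noteq> 0} = 3"
      "card {i. i < d \<and> (\<Sum>j<d. f j * ?w ^ (i * j)) = 0} = n"
      by (rule exists_fourier_support3[OF mk, folded n])
    then show "(d - n, 3) \<in> UNCD ip d a b"
      unfolding iff[OF \<open>n < d\<close>] by blast
  qed
qed

end
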